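(* Let $(\mathfrak m,V,\omega,B_\mu)$ be a special symplectic representation over $k$, and let $A\in V$. The following are equivalent: (i) $Q(A)\in {k^*}^2$ (that is, $Q(A)$ is the square of a nonzero element of $k$); (ii) there exist $B,C\in V$ such that $\mu(B)=\mu(C)=0$, $\omega(B,C)\neq 0$ and $A=B+C$. Moreover, when (i) holds, any $B$ and $C$ as in (ii) satisfy $(3\omega(B,C))^2=Q(A)$, and there is a square root $q\in k^*$ of $Q(A)$ such that $$B=\tfrac12\Bigl(A+\tfrac1q\Psi(A)\Bigr),\qquad C=\tfrac12\Bigl(A-\tfrac1q\Psi(A)\Bigr).$$ In particular, $B$ and $C$ are unique up to permutation.
   Context: $k$ is a field of characteristic not $2$ or $3$, $k^*=k\setminus\{0\}$ and ${k^*}^2=\{x^2: x\in k^*\}$. A special symplectic representation (SSR) $(\mathfrak m,V,\omega,B_\mu)$ over $k$ is a faithful representation of a Lie algebra $\mathfrak m$ over $k$ on a symplectic vector space $(V,\omega)$ ($\omega$ a nondegenerate alternating bilinear form), together with an $\mathfrak m$-equivariant symmetric bilinear map $B_\mu:V\times V\to\mathfrak m$ (equivariance: $[m,B_\mu(A,B)]=B_\mu(m\cdot A,B)+B_\mu(A,m\cdot B)$), such that for all $m\in\mathfrak m$ and $A,B,C\in V$: $$\omega(m\cdot A,B)+\omega(A,m\cdot B)=0,$$ $$2B_\mu(A,B)\cdot C-2B_\mu(A,C)\cdot B=2\omega(B,C)A-\omega(A,B)C+\omega(A,C)B.$$ Covariants: $\mu(A)=B_\mu(A,A)\in\mathfrak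 m$, $\Psi(A)=\mu(A)\cdot A\in V$, $Q(A)=\frac32\,\omega(A,\Psi(A))\in k$. *)

theory Defs
  imports Complex_Main
begin

definition bilinear_map ::
    "('k::field \<Rightarrow> 'a::ab_group_add \<Rightarrow> 'a) \<Rightarrow> ('k \<Rightarrow> 'b::ab_group_add \<Rightarrow> 'b) \<Rightarrow>
     ('k \<Rightarrow> 'c::ab_group_add \<Rightarrow> 'c) \<Rightarrow> ('a \<Rightarrow> 'b \<Rightarrow> 'c) \<Rightarrow> bool" where
  "bilinear_map s1 s2 s3 f \<longleftrightarrow>
     (\<forall>x. Vector_Spaces.linear s2 s3 (f x)) \<and>
     (\<forall>y. Vector_Spaces.linear s1 s3 (\<lambda>x. f x y))"

text \<open>
  The type of scalars is the field; Lie algebras and their modules are whole types with an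
  explicit scalar multiplication. No finite-dimensionality is imposed.
\<close>

locale lie_algebra = vector_space scale
  for scale :: "'k::field \<Rightarrow> 'm::ab_group_add \<Rightarrow> 'm" +
  fixes bracket :: "'m \<Rightarrow> 'm \<Rightarrow> 'm"
  assumes bracket_bilinear: "bilinear_map scale scale scale bracket"
    and bracket_alternating: "bracket x x = 0"
    and jacobi:
      "bracket x (bracket y z) + bracket y (bracket z x) + bracket z (bracket x y) = 0"

locale lie_representation =
    lie_algebra smult_m bracket + V: vector_space smult_V
  for smult_m :: "'k::field \<Rightarrow> 'm::ab_group_add \<Rightarrow> 'm"
    and bracket :: "'m \<Rightarrow> 'm \<Rightarrow> 'm"
    and smult_V :: "'k \<Rightarrow> 'v::ab_group_add \<Rightarrow> 'v" +
  fixes act :: "'m \<Rightarrow> 'v \<Rightarrow> 'v"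
  assumes act_bilinear: "bilinear_map smult_m smult_V smult_V act"
    and act_bracket: "act (bracket x y) v = act x (act y v) - act y (act x v)"

locale faithful_lie_representation = lie_representation +
  assumes faithful: "inj act"

locale symplectic_vector_space = vector_space scale
  for scale :: "'k::field \<Rightarrow> 'v::ab_group_add \<Rightarrow> 'v" +
  fixes \<omega> :: "'v \<Rightarrow> 'v \<Rightarrow> 'k"
  assumes form_bilinear: "bilinear_map scale scale (*) \<omega>"
    and form_alternating: "\<omega> A A = 0"
    and form_nondegenerate: "(\<And>B. \<omega> A B = 0) \<Longrightarrow> A = 0"

locale special_symplectic_representation =
    faithful_lie_representation smult_m bracket smult_V act +
    S: symplectic_vector_space smult_V \<omega>
  for smult_m :: "'k::field \<Rightarrow> 'm::ab_group_add \<Rightarrow> 'm"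
    and bracket :: "'m \<Rightarrow> 'm \<Rightarrow> 'm"
    and smult_V :: "'k \<Rightarrow> 'v::ab_group_add \<Rightarrow> 'v"
    and act :: "'m \<Rightarrow> 'v \<Rightarrow> 'v"
    and \<omega> :: "'v \<Rightarrow> 'v \<Rightarrow> 'k" +
  fixes B\<^sub>\<mu> :: "'v \<Rightarrow> 'v \<Rightarrow> 'm"
  assumes B_bilinear: "bilinear_map smult_V smult_V smult_m B\<^sub>\<mu>"
    and B_symmetric: "B\<^sub>\<mu> A B = B\<^sub>\<mu> B A"
    and B_equivariant: "bracket m (B\<^sub>\<mu> A B) = B\<^sub>\<mu> (act m A) B + B\<^sub>\<mu> A (act m B)"
    and form_invariant: "\<omega> (act m A) B + \<omega> A (act m B) = 0"
    and special:
      "smult_V 2 (act (B\<^sub>\<mu> A B) C) - smult_V 2 (act (B\<^sub>\<mu> A C) B) =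
       smult_V (2 * \<omega> B C) A - smult_V (\<omega> A B) C + smult_V (\<omega> A C) B"

definition mu :: "('v \<Rightarrow> 'v \<Rightarrow> 'm) \<Rightarrow> 'v \<Rightarrow> 'm" where
  "mu B\<^sub>\<mu> A = B\<^sub>\<mu> A A"

definition Psi :: "('m \<Rightarrow> 'v \<Rightarrow> 'v) \<Rightarrow> ('v \<Rightarrow> 'v \<Rightarrow> 'm) \<Rightarrow> 'v \<Rightarrow> 'v" where
  "Psi act B\<^sub>\<mu> A = act (mu B\<^sub>\<mu> A) A"

definition Qform ::
    "('m \<Rightarrow> 'v \<Rightarrow> 'v) \<Rightarrow> ('v \<Rightarrow> 'v \<Rightarrow> 'k::field) \<Rightarrow> ('v \<Rightarrow> 'v \<Rightarrow> 'm) \<Rightarrow> 'v \<Rightarrow> 'k" where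
  "Qform act \<omega> B\<^sub>\<mu> A = 3 / 2 * \<omega> A (Psi act B\<^sub>\<mu> A)"

definition nonzero_squares :: "'k::field set" where
  "nonzero_squares = {x\<^sup>2 | x. x \<noteq> 0}"

definition decomposes ::
    "('v::ab_group_add \<Rightarrow> 'v \<Rightarrow> 'k::field) \<Rightarrow> ('v \<Rightarrow> 'v \<Rightarrow> 'm::zero) \<Rightarrow> 'v \<Rightarrow> 'v \<Rightarrow> 'v \<Rightarrow> bool" where
  "decomposes \<omega> B\<^sub>\<mu> A B C \<longleftrightarrow>
     mu B\<^sub>\<mu> B = 0 \<and> mu B\<^sub>\<mu> C = 0 \<and> \<omega> B C \<noteq> 0 \<and> A = B + C"

end

theory Submission
  imports Defs "HOL-Computational_Algebra.Primes"
begin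

text \<open>
  Write \<open>\<mu>\<close>, \<open>\<Psi>\<close>, \<open>Q\<close> for the three covariants. Setting \<open>B = A\<close> in the defining identity of a special
  symplectic representation gives \<open>B\<^sub>\<mu>(A,C)\<cdot>A = \<mu>(A)\<cdot>C - (3/2)\<omega>(A,C)A\<close> (\<open>B_act_same\<close>); both directions
  come from this one relation and equivariance.

  If \<open>A = B + C\<close> with \<open>\<mu>(B) = \<mu>(C) = 0\<close>, then \<open>\<mu>(A) = 2 B\<^sub>\<mu>(B,C)\<close>, and the relation says that \<open>B\<close> and
  \<open>C\<close> are eigenvectors of \<open>\<mu>(A)\<close> with the opposite eigenvalues \<open>-3\<omega>(B,C)\<close> and \<open>3\<omega>(B,C)\<close>. So
  \<open>\<Psi>(A) = q(B - C)\<close> with \<open>q = -3\<omega>(B,C)\<close>, whence \<open>Q(A) = q\<^sup>2\<close> (\<open>Psi_of_decomposes\<close>,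
  \<open>Q_of_decomposes\<close>). Solving \<open>A = B + C\<close>, \<open>\<Psi>(A)/q = B - C\<close> recovers \<open>B\<close> and \<open>C\<close> from \<open>A\<close> and \<open>q\<close>,
  and since \<open>q\<close> is determined up to sign by \<open>Q(A)\<close>, the pair is unique up to order.

  Conversely, if \<open>Q(A) = q\<^sup>2\<close>, these same formulas define \<open>B\<close> and \<open>C\<close>, and one must see that
  \<open>\<mu>(A \<plusminus> \<Psi>(A)/q) = \<mu>(A) \<plusminus> (2/q) B\<^sub>\<mu>(A,\<Psi>(A)) + \<mu>(\<Psi>(A))/q\<^sup>2\<close> vanishes. The cross term is zero because,
  by equivariance, \<open>2 B\<^sub>\<mu>(A,\<Psi>(A)) = [\<mu>(A),\<mu>(A)] = 0\<close>. The outer terms cancel because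
  \<open>\<mu>(\<Psi>(A)) = -Q(A)\<mu>(A)\<close>, which follows on applying \<open>ad \<mu>(A)\<close> to \<open>B\<^sub>\<mu>(A,\<Psi>(A)) = 0\<close> and using
  \<open>\<mu>(A)\<cdot>\<Psi>(A) = Q(A)A\<close>. Finally \<open>2q \<omega>(B,C) = -\<omega>(A,\<Psi>(A))\<close>, which is nonzero because \<open>Q(A)\<close> is.
\<close>

section \<open>Characteristic and bilinearity\<close>

lemma of_nat_prime_neq_0:
  assumes "prime p" and "CHAR('k::field) \<noteq> p"
  shows "(of_nat p :: 'k) \<noteq> 0"
proof
  assume "(of_nat p :: 'k) = 0"
  then have "CHAR('k) dvd p"
    by (simp add: of_nat_eq_0_iff_char_dvd)
  with assms have "CHAR('k) = 1"
    by (auto simp: prime_nat_iff)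
  then show False
    by simp
qed

lemma bilinear_mapD:
  assumes "bilinear_map s1 s2 s3 f"
  shows "f (x + x') y = f x y + f x' y"
    and "f x (y + y') = f x y + f x y'"
    and "f (x - x') y = f x y - f x' y"
    and "f x (y - y') = f x y - f x y'"
    and "f (s1 c x) y = s3 c (f x y)"
    and "f x (s2 c y) = s3 c (f x y)"
    and "f (- x) y = - f x y"
    and "f x (- y) = - f x y"
    and "f 0 y = 0"
    and "f x 0 = 0"
proof -
  interpret L: Vector_Spaces.linear s1 s3 "\<lambda>x. f x y" for y
    using assms by (simp add: bilinear_map_def)
  interpret R: Vector_Spaces.linear s2 s3 "f x" for x
    using assms by (simp add: bilinear_map_def)
  show "f (x + x') y = f x y + f x' y" "f (x - x') y = f x y - f x' y"
    "f (s1 c x) y = s3 c (f x y)" "f (- x) y = - f x y" "f 0 y = 0"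
    by (fact L.add L.diff L.scale L.neg L.zero)+
  show "f x (y + y') = f x y + f x y'" "f x (y - y') = f x y - f x y'"
    "f x (s2 c y) = s3 c (f x y)" "f x (- y) = - f x y" "f x 0 = 0"
    by (fact R.add R.diff R.scale R.neg R.zero)+
qed

section \<open>Identities between the covariants\<close>

context special_symplectic_representation
begin

lemmas act_linear = bilinear_mapD [OF act_bilinear]
lemmas B_linear = bilinear_mapD [OF B_bilinear]
lemmas form_linear = bilinear_mapD [OF S.form_bilinear]

abbreviation "\<mu> \<equiv> mu B\<^sub>\<mu>"
abbreviation "\<Psi> \<equiv> Psi act B\<^sub>\<mu>"
abbreviation "Q \<equiv> Qform act \<omega> B\<^sub>\<mu>"

lemma form_skew: "\<omega> B A = - \<omega> A B"
proof -
  have "\<omega> A B + \<omega> B A = \<omega> (A + B) (A + B)"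
    by (simp only: form_linear) (simp add: S.form_alternating)
  then have "\<omega> A B + \<omega> B A = 0"
    by (simp only: S.form_alternating)
  then show ?thesis
    by (rule minus_unique [symmetric])
qed

text \<open>
  This is the special identity with its first two arguments equal. It is used in two cases where a
  term drops out: for \<open>C = \<Psi> A\<close> the left side vanishes, and for \<open>\<mu> A = 0\<close> it exhibits \<open>A\<close> as an
  eigenvector of \<open>B\<^sub>\<mu> A C\<close>.
\<close>

lemma B_act_same:
  assumes "(2::'k) \<noteq> 0"
  shows "act (B\<^sub>\<mu> A C) A = act (\<mu> A) C - smult_V (3 / 2 * \<omega> A C) A"
proof -
  have "smult_V 2 (act (B\<^sub>\<mu> A A) C - act (B\<^sub>\<mu> A C) A)
      = smult_V (2 * \<omega> A C) A + smult_V (\<omega> A C) A"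
    using special [of A A C]
    by (simp add: S.form_alternating V.scale_right_diff_distrib)
  also have "\<dots> = smult_V (3 * \<omega> A C) A"
    by (simp flip: V.scale_left_distrib)
  also have "\<dots> = smult_V 2 (smult_V (3 / 2 * \<omega> A C) A)"
    using assms by (simp add: algebra_simps)
  finally have "act (B\<^sub>\<mu> A A) C - act (B\<^sub>\<mu> A C) A = smult_V (3 / 2 * \<omega> A C) A"
    using assms by (simp only: V.scale_cancel_left) simp
  then show ?thesis
    by (simp add: mu_def algebra_simps)
qed

text \<open>Equivariance turns twice the left side into the bracket of \<open>\<mu> A\<close> with itself.\<close>

lemma B_Psi_eq_0:
  assumes "(2::'k) \<noteq> 0"
  shows "B\<^sub>\<mu> A (\<Psi> A) = 0"
proof -
  have "B\<^sub>\<mu> A (\<Psi> A) + B\<^sub>\<mu> A (\<Psi> A) = bracket (\<mu> A) (\<mu> A)"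
    using B_equivariant [of "\<mu> A" A A] B_symmetric [of A "\<Psi> A"]
    by (simp add: mu_def Psi_def)
  also have "\<dots> = 0"
    by (rule bracket_alternating)
  finally have "smult_m 2 (B\<^sub>\<mu> A (\<Psi> A)) = 0"
    using scale_left_distrib [of 1 1] by simp
  with assms show ?thesis
    by simp
qed

text \<open>
  Since \<open>\<mu> A\<close> sends \<open>A\<close> to \<open>\<Psi> A\<close>, its square acts as the scalar \<open>Q A\<close> on the span of \<open>A\<close> and \<open>\<Psi> A\<close>.
  This is why square roots of \<open>Q A\<close> appear: the vectors \<open>B\<close> and \<open>C\<close> of a decomposition are the
  eigenvectors of \<open>\<mu> A\<close> in this span.
\<close>

lemma mu_act_Psi:
  assumes "(2::'k) \<noteq> 0"
  shows "act (\<mu> A) (\<Psi> A) = smult_V (Q A) A"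
  using B_act_same [OF assms, of A "\<Psi> A"]
  by (simp add: B_Psi_eq_0 [OF assms] act_linear Qform_def)

text \<open>Apply \<open>ad (\<mu> A)\<close> to the vanishing element \<open>B\<^sub>\<mu> A (\<Psi> A)\<close>.\<close>

lemma mu_Psi:
  assumes "(2::'k) \<noteq> 0"
  shows "\<mu> (\<Psi> A) = - smult_m (Q A) (\<mu> A)"
proof -
  have "0 = bracket (\<mu> A) (B\<^sub>\<mu> A (\<Psi> A))"
    by (simp add: B_Psi_eq_0 [OF assms] bilinear_mapD [OF bracket_bilinear])
  also have "\<dots> = B\<^sub>\<mu> (\<Psi> A) (\<Psi> A) + B\<^sub>\<mu> A (act (\<mu> A) (\<Psi> A))"
    by (simp add: B_equivariant Psi_def)
  also have "\<dots> = \<mu> (\<Psi> A) + smult_m (Q A) (\<mu> A)"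
    by (simp add: mu_act_Psi [OF assms] B_linear) (simp add: mu_def)
  finally show ?thesis
    by (simp add: eq_neg_iff_add_eq_0)
qed

section \<open>From a square root of \<open>Q A\<close> to a decomposition\<close>

text \<open>
  Any square root of \<open>Q A\<close> will do. In particular the lemma applies to \<open>-q\<close> as well as \<open>q\<close>, which
  handles both summands of the decomposition at once.
\<close>

lemma mu_half_sum_eq_0:
  assumes two: "(2::'k) \<noteq> 0" and q: "q \<noteq> 0" "q\<^sup>2 = Q A"
  shows "\<mu> (smult_V (1 / 2) (A + smult_V (1 / q) (\<Psi> A))) = 0"
proof -
  have cross: "B\<^sub>\<mu> A (\<Psi> A) = 0" "B\<^sub>\<mu> (\<Psi> A) A = 0"
    using B_Psi_eq_0 [OF two] by (simp_all add: B_symmetric [of "\<Psi> A" A])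
  have "\<mu> (A + smult_V (1 / q) (\<Psi> A)) = \<mu> A + smult_m (1 / q * (1 / q)) (\<mu> (\<Psi> A))"
    by (simp add: mu_def B_linear cross)
  also have "\<dots> = \<mu> A - smult_m (1 / q * (1 / q) * q\<^sup>2) (\<mu> A)"
    by (simp add: mu_Psi [OF two] q(2))
  also have "\<dots> = 0"
    using q(1) by (simp add: power2_eq_square)
  finally have "\<mu> (A + smult_V (1 / q) (\<Psi> A)) = 0" .
  moreover have "\<mu> (smult_V c X) = smult_m (c * c) (\<mu> X)" for c X
    by (simp add: mu_def B_linear)
  ultimately show ?thesis
    by simp
qed

lemma decomposes_of_square_root:
  assumes two: "(2::'k) \<noteq> 0" and q: "q \<noteq> 0" "q\<^sup>2 = Q A"
  shows "decomposes \<omega> B\<^sub>\<mu> A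
    (smult_V (1 / 2) (A + smult_V (1 / q) (\<Psi> A)))
    (smult_V (1 / 2) (A - smult_V (1 / q) (\<Psi> A)))"
    (is "decomposes _ _ _ ?B ?C")
proof -
  have four: "(4::'k) \<noteq> 0"
    using two mult_eq_0_iff [of "2::'k" 2] by simp
  have half: "(1 / 2 + 1 / 2 :: 'k) = 1"
    using two by (simp add: field_simps)
  have "?B + ?C = smult_V (1 / 2 + 1 / 2) A"
    unfolding V.scale_left_distrib
    by (simp add: V.scale_right_distrib V.scale_right_diff_distrib)
  then have sum: "A = ?B + ?C"
    by (simp only: half V.scale_one)
  have "\<mu> ?C = 0"
    using mu_half_sum_eq_0 [OF two, of "- q" A] q by simp
  moreover have "\<mu> ?B = 0"
    by (rule mu_half_sum_eq_0 [OF two q])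
  moreover have "\<omega> ?B ?C \<noteq> 0"
  proof
    assume "\<omega> ?B ?C = 0"
    moreover have "2 * q * \<omega> ?B ?C = - \<omega> A (\<Psi> A)"
      using two four q(1) form_skew [of "\<Psi> A" A]
      by (simp add: form_linear S.form_alternating field_simps)
    ultimately have "\<omega> A (\<Psi> A) = 0"
      by (metis mult_zero_right neg_equal_0_iff_equal)
    then have "Q A = 0"
      by (simp add: Qform_def)
    with q show False
      by (metis power_not_zero)
  qed
  ultimately show ?thesis
    using sum by (simp add: decomposes_def)
qed

section \<open>From a decomposition to a square root of \<open>Q A\<close>\<close>

text \<open>
  \<open>\<mu> B = \<mu> C = 0\<close> leaves only the cross term \<open>2 B\<^sub>\<mu> B C\<close> in \<open>\<mu> A\<close>, and \<open>B\<close>, \<open>C\<close> are eigenvectors of it; the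
  eigenvalues are opposite because \<open>\<omega>\<close> is skew.
\<close>

lemma Psi_of_decomposes:
  assumes two: "(2::'k) \<noteq> 0" and dec: "decomposes \<omega> B\<^sub>\<mu> A B C"
  shows "\<Psi> A = smult_V (- 3 * \<omega> B C) (B - C)"
proof -
  have null: "\<mu> B = 0" "\<mu> C = 0" and A: "A = B + C"
    using dec by (simp_all add: decomposes_def)
  have B: "act (B\<^sub>\<mu> B C) B = smult_V (- 3 / 2 * \<omega> B C) B"
    using B_act_same [OF two, of B C] by (simp add: null act_linear)
  have C: "act (B\<^sub>\<mu> B C) C = smult_V (3 / 2 * \<omega> B C) C"
    using B_act_same [OF two, of C B]
    by (simp add: null act_linear B_symmetric [of C B] form_skew [of C B])
  have six: "6 * x / 2 = 3 * x" for x :: 'k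
    using two by (simp add: field_simps)
  have "\<mu> A = smult_m 2 (B\<^sub>\<mu> B C)"
    using null scale_left_distrib [of 1 1 "B\<^sub>\<mu> B C"]
    by (simp add: mu_def A B_linear B_symmetric [of C B])
  then have "\<Psi> A = smult_V 2 (act (B\<^sub>\<mu> B C) B + act (B\<^sub>\<mu> B C) C)"
    by (simp add: Psi_def A act_linear V.scale_right_distrib)
  also have "\<dots> = smult_V (- 3 * \<omega> B C) (B - C)"
    using two by (simp add: six B C V.scale_right_distrib V.scale_right_diff_distrib)
  finally show ?thesis .
qed

lemma Q_of_decomposes:
  assumes two: "(2::'k) \<noteq> 0" and dec: "decomposes \<omega> B\<^sub>\<mu> A B C"
  shows "Q A = (3 * \<omega> B C)\<^sup>2"
proof -
  have "A = B + C"
    using dec by (simp add: decomposes_def)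
  then have "\<omega> A (B - C) = - 2 * \<omega> B C"
    by (simp add: form_linear S.form_alternating form_skew [of C B])
  then show ?thesis
    using two by (simp add: Qform_def Psi_of_decomposes [OF assms] form_linear power2_eq_square)
qed

lemma decomposes_explicit:
  assumes two: "(2::'k) \<noteq> 0" and three: "(3::'k) \<noteq> 0"
    and dec: "decomposes \<omega> B\<^sub>\<mu> A B C"
  obtains q where "q \<noteq> 0" and "q\<^sup>2 = Q A"
    and "B = smult_V (1 / 2) (A + smult_V (1 / q) (\<Psi> A))"
    and "C = smult_V (1 / 2) (A - smult_V (1 / q) (\<Psi> A))"
proof
  \<comment> \<open>the sign for which \<open>\<Psi> A / q\<close> is \<open>B - C\<close> and not \<open>C - B\<close>\<close>
  let ?q = "- 3 * \<omega> B C"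
  have A: "A = B + C" and q: "?q \<noteq> 0"
    using dec three by (simp_all add: decomposes_def)
  show "?q \<noteq> 0"
    by (fact q)
  show "?q\<^sup>2 = Q A"
    by (simp add: Q_of_decomposes [OF two dec])
  have Psi: "smult_V (1 / ?q) (\<Psi> A) = B - C"
    unfolding Psi_of_decomposes [OF two dec] using q by simp
  have half: "X = smult_V (1 / 2) (X + X)" for X
    using two V.scale_left_distrib [of 1 1 X]
    by (metis V.scale_one V.scale_scale nonzero_eq_divide_eq one_add_one)
  show "B = smult_V (1 / 2) (A + smult_V (1 / ?q) (\<Psi> A))"
    using half [of B] by (simp only: Psi) (simp add: A)
  show "C = smult_V (1 / 2) (A - smult_V (1 / ?q) (\<Psi> A))"
    using half [of C] by (simp only: Psi) (simp add: A)
qed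

text \<open>The only freedom is the sign of \<open>q\<close>, and changing it exchanges the two formulas.\<close>

lemma decomposes_unique:
  assumes two: "(2::'k) \<noteq> 0" and three: "(3::'k) \<noteq> 0"
    and dec: "decomposes \<omega> B\<^sub>\<mu> A B C" and dec': "decomposes \<omega> B\<^sub>\<mu> A B' C'"
  shows "B' = B \<and> C' = C \<or> B' = C \<and> C' = B"
proof -
  obtain q where q: "q\<^sup>2 = Q A"
    and BC: "B = smult_V (1 / 2) (A + smult_V (1 / q) (\<Psi> A))"
      "C = smult_V (1 / 2) (A - smult_V (1 / q) (\<Psi> A))"
    by (rule decomposes_explicit [OF two three dec])
  obtain q' where q': "q'\<^sup>2 = Q A"
    and BC': "B' = smult_V (1 / 2) (A + smult_V (1 / q') (\<Psi> A))"
      "C' = smult_V (1 / 2) (A - smult_V (1 / q') (\<Psi> A))"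
    by (rule decomposes_explicit [OF two three dec'])
  have "q' = q \<or> q' = - q"
    using q q' by (metis power2_eq_iff)
  then show ?thesis
    unfolding BC BC' by auto
qed

end

section \<open>The decomposition theorem\<close>

theorem theorem4p4:
  fixes smult_m :: "'k::field \<Rightarrow> 'm::ab_group_add \<Rightarrow> 'm"
    and bracket :: "'m \<Rightarrow> 'm \<Rightarrow> 'm"
    and smult_V :: "'k \<Rightarrow> 'v::ab_group_add \<Rightarrow> 'v"
    and act :: "'m \<Rightarrow> 'v \<Rightarrow> 'v"
    and \<omega> :: "'v \<Rightarrow> 'v \<Rightarrow> 'k"
    and B\<^sub>\<mu> :: "'v \<Rightarrow> 'v \<Rightarrow> 'm"
    and A :: 'v
  assumes "CHAR('k) \<noteq> 2" and "CHAR('k) \<noteq> 3"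
    and "special_symplectic_representation smult_m bracket smult_V act \<omega> B\<^sub>\<mu>"
  shows "(Qform act \<omega> B\<^sub>\<mu> A \<in> nonzero_squares \<longleftrightarrow> (\<exists>B C. decomposes \<omega> B\<^sub>\<mu> A B C)) \<and>
    (Qform act \<omega> B\<^sub>\<mu> A \<in> nonzero_squares \<longrightarrow>
      (\<forall>B C. decomposes \<omega> B\<^sub>\<mu> A B C \<longrightarrow>
         (3 * \<omega> B C)\<^sup>2 = Qform act \<omega> B\<^sub>\<mu> A \<and>
         (\<exists>q. q \<noteq> 0 \<and> q\<^sup>2 = Qform act \<omega> B\<^sub>\<mu> A \<and>
            B = smult_V (1 / 2) (A + smult_V (1 / q) (Psi act B\<^sub>\<mu> A)) \<and>
            C = smult_V (1 / 2) (A - smult_V (1 / q) (Psi act B\<^sub>\<mu> A)))) \<and>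
      (\<forall>B C B' C'. decomposes \<omega> B\<^sub>\<mu> A B C \<longrightarrow> decomposes \<omega> B\<^sub>\<mu> A B' C' \<longrightarrow>
         (B' = B \<and> C' = C) \<or> (B' = C \<and> C' = B)))"
proof -
  interpret special_symplectic_representation smult_m bracket smult_V act \<omega> B\<^sub>\<mu>
    by (rule assms(3))
  have two: "(2::'k) \<noteq> 0"
    using of_nat_prime_neq_0 [OF two_is_prime_nat assms(1)] by simp
  have three: "(3::'k) \<noteq> 0"
    using of_nat_prime_neq_0 [of 3, OF _ assms(2)] by simp
  have "Q A \<in> nonzero_squares \<longleftrightarrow> (\<exists>B C. decomposes \<omega> B\<^sub>\<mu> A B C)"
  proof
    assume "Q A \<in> nonzero_squares"
    then obtain q where "q \<noteq> 0" "q\<^sup>2 = Q A"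
      by (auto simp: nonzero_squares_def)
    from decomposes_of_square_root [OF two this] show "\<exists>B C. decomposes \<omega> B\<^sub>\<mu> A B C"
      by blast
  next
    assume "\<exists>B C. decomposes \<omega> B\<^sub>\<mu> A B C"
    then obtain B C where "decomposes \<omega> B\<^sub>\<mu> A B C"
      by blast
    then obtain q where "q \<noteq> 0" "q\<^sup>2 = Q A"
      by (rule decomposes_explicit [OF two three])
    then show "Q A \<in> nonzero_squares"
      unfolding nonzero_squares_def by (auto intro!: exI [of _ q])
  qed
  moreover have "(3 * \<omega> B C)\<^sup>2 = Q A \<and>
      (\<exists>q. q \<noteq> 0 \<and> q\<^sup>2 = Q A \<and>
        B = smult_V (1 / 2) (A + smult_V (1 / q) (\<Psi> A)) \<and>
        C = smult_V (1 / 2) (A - smult_V (1 / q) (\<Psi> A)))"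
    if dec: "decomposes \<omega> B\<^sub>\<mu> A B C" for B C
    by (rule decomposes_explicit [OF two three dec])
      (use Q_of_decomposes [OF two dec] in auto)
  ultimately show ?thesis
    using decomposes_unique [OF two three] by blast
qed

end
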